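(* Let $(V,H,L)$ be a holonomic space. Then the action $H\times V\to V$, $(a,u)\mapsto au$, is continuous with respect to the $L$-topology on $H$. Furthermore, it is uniformly continuous when restricted to bounded invariant sets (i.e. as a map $H\times B\to V$ for $B\subseteq V$ bounded and $H$-invariant).
   Context: A group-norm on a group $G$ is a function $N:G\to\mathbb{R}$ such that $N(A)\ge 0$; $N(A)=0$ if and only if $A$ is the identity; $N(A^{-1})=N(A)$; and $N(AB)\le N(A)+N(B)$, for all $A,B\in G$. A triplet $(V,H,L)$, with $V$ a normed vector space, $H$ a subgroup of the group of norm-preserving linear automorphisms of $V$, and $L:H\to\mathbb{R}$ a group-norm on $H$, is a holonomic space if: for all $u\in V$ there exists $r>0$ such that for all $v,w\in V$ with $\|v-u\|<r$, $\|w-u\|<r$, and all $A\in H$, $$\|v-w\|^2-\|v-Aw\|^2\le L^2(A).$$ The $L$-topology on $H$ is the topology induced by the left-invariant metric $d(a,b)=L(a^{-1}b)$. The product $H\times V$ carries the product metric $\sqrt{L^2(a^{-1}b)+\|u-v\|^2}$. *)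

theory Defs
  imports "HOL-Analysis.Analysis" "HOL-Algebra.Group"
begin

locale group_norm = group G for G (structure) +
  fixes N :: "'a \<Rightarrow> real"
  assumes nonneg: "a \<in> carrier G \<Longrightarrow> 0 \<le> N a"
    and eq_0_iff: "a \<in> carrier G \<Longrightarrow> N a = 0 \<longleftrightarrow> a = \<one>"
    and norm_inv: "a \<in> carrier G \<Longrightarrow> N (inv a) = N a"
    and norm_mult: "a \<in> carrier G \<Longrightarrow> b \<in> carrier G \<Longrightarrow> N (a \<otimes> b) \<le> N a + N b"

text \<open>The left-invariant metric of a group-norm. The library's metrics are nonnegative and
  symmetric on the whole type, not just on the carrier, hence the default value 0 elsewhere.\<close>
definition group_norm_dist :: "('a, 'b) monoid_scheme \<Rightarrow> ('a \<Rightarrow> real) \<Rightarrow> 'a \<Rightarrow> 'a \<Rightarrow> real" where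
  "group_norm_dist G N a b =
    (if a \<in> carrier G \<and> b \<in> carrier G then N (inv\<^bsub>G\<^esub> a \<otimes>\<^bsub>G\<^esub> b) else 0)"

definition group_norm_metric :: "('a, 'b) monoid_scheme \<Rightarrow> ('a \<Rightarrow> real) \<Rightarrow> 'a metric" where
  "group_norm_metric G N = metric (carrier G, group_norm_dist G N)"

context group_norm
begin

lemma Metric_space_group_norm_dist: "Metric_space (carrier G) (group_norm_dist G N)"
proof
  fix x y
  show "0 \<le> group_norm_dist G N x y"
    by (simp add: group_norm_dist_def nonneg)
  have "N (inv x \<otimes> y) = N (inv y \<otimes> x)" if "x \<in> carrier G" "y \<in> carrier G"
    using norm_inv[of "inv x \<otimes> y"] that by (simp add: inv_mult_group)
  then show "group_norm_dist G N x y = group_norm_dist G N y x"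
    by (auto simp: group_norm_dist_def)
next
  fix x y assume "x \<in> carrier G" "y \<in> carrier G"
  then show "group_norm_dist G N x y = 0 \<longleftrightarrow> x = y"
    using inv_solve_left[of \<one> x y] by (auto simp: group_norm_dist_def eq_0_iff)
next
  fix x y z assume xyz: "x \<in> carrier G" "y \<in> carrier G" "z \<in> carrier G"
  then have "inv x \<otimes> z = (inv x \<otimes> y) \<otimes> (inv y \<otimes> z)"
    by (simp add: m_assoc inv_solve_left flip: m_assoc[of y "inv y" z])
  with xyz show "group_norm_dist G N x z \<le> group_norm_dist G N x y + group_norm_dist G N y z"
    by (simp add: group_norm_dist_def norm_mult)
qed

lemma mspace_group_norm_metric [simp]: "mspace (group_norm_metric G N) = carrier G"
  and mdist_group_norm_metric [simp]: "mdist (group_norm_metric G N) = group_norm_dist G N"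
  using Metric_space_group_norm_dist
  by (simp_all add: group_norm_metric_def Metric_space.mspace_metric Metric_space.mdist_metric)

end

definition norm_aut_group :: "('v::real_normed_vector \<Rightarrow> 'v) monoid" where
  "norm_aut_group = \<lparr>carrier = {f. linear f \<and> bij f \<and> (\<forall>v. norm (f v) = norm v)},
     mult = (\<circ>), one = id\<rparr>"

lemma group_norm_aut_group: "group (norm_aut_group :: ('v::real_normed_vector \<Rightarrow> 'v) monoid)"
proof (rule groupI)
  fix f :: "'v \<Rightarrow> 'v" assume "f \<in> carrier norm_aut_group"
  then have f: "linear f" "bij f" "\<And>v. norm (f v) = norm v"
    by (auto simp: norm_aut_group_def)
  have lin: "linear (inv_into UNIV f)"
  proof (rule linearI)
    fix x y c
    show "inv_into UNIV f (x + y) = inv_into UNIV f x + inv_into UNIV f y"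
      by (rule inv_f_eq) (use f in \<open>simp_all add: linear_add bij_is_inj surj_f_inv_f bij_is_surj\<close>)
    show "inv_into UNIV f (c *\<^sub>R x) = c *\<^sub>R inv_into UNIV f x"
      by (rule inv_f_eq) (use f in \<open>simp_all add: linear_scale bij_is_inj surj_f_inv_f bij_is_surj\<close>)
  qed
  have "norm (inv_into UNIV f v) = norm v" for v
    using f(3)[of "inv_into UNIV f v"] f(2) by (simp add: surj_f_inv_f bij_is_surj)
  with f lin have "inv_into UNIV f \<in> carrier norm_aut_group"
    by (auto simp: norm_aut_group_def bij_imp_bij_inv)
  moreover have "inv_into UNIV f \<circ> f = id"
    using f(2) by (simp add: bij_is_inj)
  ultimately show "\<exists>g\<in>carrier norm_aut_group. g \<otimes>\<^bsub>norm_aut_group\<^esub> f = \<one>\<^bsub>norm_aut_group\<^esub>"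
    by (auto simp: norm_aut_group_def)
qed (auto simp: norm_aut_group_def linear_compose bij_comp comp_assoc linear_id)

text \<open>The space V is the carrier type \<open>'v\<close>; the group H is the set of its elements, with composition
  inherited from \<^const>\<open>norm_aut_group\<close>.\<close>
abbreviation hol_group :: "('v::real_normed_vector \<Rightarrow> 'v) set \<Rightarrow> ('v \<Rightarrow> 'v) monoid" where
  "hol_group H \<equiv> norm_aut_group\<lparr>carrier := H\<rparr>"

definition holonomic_space :: "('v::real_normed_vector \<Rightarrow> 'v) set \<Rightarrow> (('v \<Rightarrow> 'v) \<Rightarrow> real) \<Rightarrow> bool" where
  "holonomic_space H L \<longleftrightarrow>
     subgroup H norm_aut_group \<and> group_norm (hol_group H) L \<and>
     (\<forall>u. \<exists>r>0. \<forall>v w. norm (v - u) < r \<longrightarrow> norm (w - u) < r \<longrightarrow>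
        (\<forall>A\<in>H. (norm (v - w))\<^sup>2 - (norm (v - A w))\<^sup>2 \<le> (L A)\<^sup>2))"

end

theory Submission
  imports Defs
begin

text \<open>Near the origin, the defining inequality with \<open>v = A w\<close> reads \<open>\<parallel>A w - w\<parallel> \<le> L A\<close>; here
  \<open>A w\<close> lies in the same ball as \<open>w\<close> because \<open>A\<close> preserves the norm. By homogeneity
  \<open>\<parallel>A w - w\<parallel> \<le> C * \<parallel>w\<parallel> * L A\<close> for all \<open>w\<close>, so the action is Lipschitz in each variable, with a
  constant that depends only on the norm of one of the two points compared.\<close>

lemma holonomic_space_displacement_bound:
  fixes H :: "('v::real_normed_vector \<Rightarrow> 'v) set"
  assumes "holonomic_space H L"
  obtains C where "C > 0" "\<And>A w. A \<in> H \<Longrightarrow> norm (A w - w) \<le> C * norm w * L A"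
proof -
  from assms interpret group_norm "hol_group H" L
    by (simp add: holonomic_space_def)
  \<comment> \<open>The holonomy condition is taken at the base point 0: its ball is then given by
    \<open>norm v < r\<close> alone, and every element of \<open>H\<close> maps that ball to
    itself.\<close>
  from assms obtain r where r: "r > 0"
    and hol: "\<And>v w A. norm v < r \<Longrightarrow> norm w < r \<Longrightarrow> A \<in> H \<Longrightarrow>
        (norm (v - w))\<^sup>2 - (norm (v - A w))\<^sup>2 \<le> (L A)\<^sup>2"
    unfolding holonomic_space_def by (metis diff_zero)
  have "norm (A w - w) \<le> 2 / r * norm w * L A" if A: "A \<in> H" for A w
  proof (cases "w = 0")
    case True
    with A assms show ?thesis
      using subgroup.subset[of H norm_aut_group]
      by (auto simp: holonomic_space_def norm_aut_group_def linear_0)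
  next
    case False
    from A assms have lin: "linear A" and iso: "\<And>v. norm (A v) = norm v"
      using subgroup.subset[of H norm_aut_group]
      by (auto simp: holonomic_space_def norm_aut_group_def)
    \<comment> \<open>Scaling by \<open>t\<close> moves \<open>w\<close> to norm
      \<open>r / 2\<close>, strictly inside the ball. Undoing it by linearity divides by
      \<open>t\<close>, which is where the constant \<open>2 / r\<close> and the factor
      \<open>norm w\<close> come from.\<close>
    define t where "t = r / (2 * norm w)"
    have t: "t > 0" using r False by (simp add: t_def)
    have "norm (t *\<^sub>R w) < r" using r False by (simp add: t_def)
    then have "(norm (A (t *\<^sub>R w) - t *\<^sub>R w))\<^sup>2 \<le> (L A)\<^sup>2"
      using hol[of "A (t *\<^sub>R w)" "t *\<^sub>R w" A] A by (simp add: iso)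
    then have "norm (A (t *\<^sub>R w) - t *\<^sub>R w) \<le> L A"
      by (rule power2_le_imp_le) (use nonneg A in simp)
    moreover have "A (t *\<^sub>R w) - t *\<^sub>R w = t *\<^sub>R (A w - w)"
      by (simp add: linear_scale[OF lin] scaleR_diff_right)
    ultimately have "t * norm (A w - w) \<le> L A" using t by simp
    then show ?thesis using r False by (simp add: t_def field_simps)
  qed
  with r show thesis by (intro that[of "2 / r"]) auto
qed

text \<open>Passing through the intermediate point \<open>b u\<close> separates the change of group
  element from the change of vector. The displacement bound is applied only at \<open>u\<close>, so
  the factor does not involve \<open>v\<close>.\<close>

lemma holonomic_space_action_dist_bound:
  fixes H :: "('v::real_normed_vector \<Rightarrow> 'v) set"
  assumes "holonomic_space H L"
  obtains C where "C > 0"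
    "\<And>a b u v. a \<in> H \<Longrightarrow> b \<in> H \<Longrightarrow>
      dist (a u) (b v) \<le>
        (1 + C * norm u) * prod_dist (group_norm_dist (hol_group H) L) dist (a, u) (b, v)"
proof -
  from assms interpret group_norm "hol_group H" L
    by (simp add: holonomic_space_def)
  obtain C where C: "C > 0" and disp: "\<And>A w. A \<in> H \<Longrightarrow> norm (A w - w) \<le> C * norm w * L A"
    using holonomic_space_displacement_bound[OF assms] by blast
  have "dist (a u) (b v) \<le> (1 + C * norm u) *
      prod_dist (group_norm_dist (hol_group H) L) dist (a, u) (b, v)"
    (is "_ \<le> _ * ?d") if a: "a \<in> H" and b: "b \<in> H" for a b u v
  proof -
    from a assms have lin: "linear a" and iso: "\<And>v. norm (a v) = norm v"
      using subgroup.subset[of H norm_aut_group]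
      by (auto simp: holonomic_space_def norm_aut_group_def)
    \<comment> \<open>By left invariance, \<open>L g\<close> is the distance from \<open>a\<close>
      to \<open>b\<close>.\<close>
    define g where "g = inv\<^bsub>hol_group H\<^esub> a \<otimes>\<^bsub>hol_group H\<^esub> b"
    have g: "g \<in> H" 
      using m_closed[of "inv\<^bsub>hol_group H\<^esub> a" b] inv_closed[of a] a b unfolding g_def by simp
    have "a \<otimes>\<^bsub>hol_group H\<^esub> g = b"
      using inv_solve_left[of g a b] a b g unfolding g_def by simp
    then have b_eq: "b = a \<circ> g" by (simp add: norm_aut_group_def)
    have d: "?d = sqrt ((L g)\<^sup>2 + (dist u v)\<^sup>2)"
      using a b by (simp add: prod_dist_def group_norm_dist_def g_def)
    have iso_g: "norm (g x) = norm x" and lin_g: "linear g" for x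
      using g assms subgroup.subset[of H norm_aut_group]
      by (auto simp: holonomic_space_def norm_aut_group_def)
    have "dist (a u) (b v) \<le> dist (a u) (b u) + dist (b u) (b v)"
      by (rule dist_triangle)
    \<comment> \<open>Since \<open>b = a \<circ> g\<close>, the first distance is the norm of
      \<open>a (u - g u)\<close> and the second that of \<open>a (g (u - v))\<close>; both maps
      preserve norms.\<close>
    also have "\<dots> = norm (g u - u) + dist u v"
      by (simp add: b_eq dist_norm iso iso_g norm_minus_commute
          flip: linear_diff[OF lin] linear_diff[OF lin_g])
    also have "\<dots> \<le> C * norm u * L g + dist u v"
      using disp g by simp
    \<comment> \<open>Each of \<open>L g\<close> and \<open>dist u v\<close> is at most the root of
      the sum of their squares.\<close>
    also have "\<dots> \<le> C * norm u * ?d + ?d"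
      using C unfolding d by (intro add_mono mult_left_mono) (auto intro: real_le_rsqrt)
    finally show ?thesis by (simp add: algebra_simps)
  qed
  with C show thesis by (rule that)
qed

theorem lemma2p6:
  fixes H :: "('v::real_normed_vector \<Rightarrow> 'v) set" and L :: "('v \<Rightarrow> 'v) \<Rightarrow> real"
  assumes "holonomic_space H L"
  shows "continuous_map
           (mtopology_of (prod_metric (group_norm_metric (hol_group H) L) euclidean_metric))
           euclidean (\<lambda>(a, u). a u) \<and>
         (\<forall>B. bounded B \<longrightarrow> (\<forall>a\<in>H. a ` B \<subseteq> B) \<longrightarrow>
           uniformly_continuous_map
             (prod_metric (group_norm_metric (hol_group H) L) (submetric euclidean_metric B))
             euclidean_metric (\<lambda>(a, u). a u))"
proof -
  from assms interpret group_norm "hol_group H" L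
    by (simp add: holonomic_space_def)
  interpret HV: Metric_space12 H "group_norm_dist (hol_group H) L" "UNIV :: 'v set" dist
    using Metric_space_group_norm_dist by (simp add: Metric_space12_def Met_TC.Metric_space_axioms)
  let ?d = "prod_dist (group_norm_dist (hol_group H) L) dist"
  obtain C where C: "C > 0" and bound: "\<And>a b u v. a \<in> H \<Longrightarrow> b \<in> H \<Longrightarrow>
      dist (a u) (b v) \<le> (1 + C * norm u) * ?d (a, u) (b, v)"
    using holonomic_space_action_dist_bound[OF assms] by blast
  have "\<exists>\<delta>>0. \<forall>b v. b \<in> H \<and> ?d (a, u) (b, v) < \<delta> \<longrightarrow> dist (a u) (b v) < \<epsilon>"
    if "a \<in> H" "\<epsilon> > 0" for a u \<epsilon>
  proof (intro exI conjI allI impI)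
    \<comment> \<open>Continuity is checked at a fixed \<open>(a, u)\<close>, so
      \<open>\<delta>\<close> may depend on \<open>norm u\<close>.\<close>
    have pos: "1 + C * norm u > 0" using C by (simp add: add_pos_nonneg)
    then show "\<epsilon> / (1 + C * norm u) > 0" using that by simp
    fix b v assume "b \<in> H \<and> ?d (a, u) (b, v) < \<epsilon> / (1 + C * norm u)"
    with bound[of a b u v] pos that show "dist (a u) (b v) < \<epsilon>"
      by (simp add: pos_less_divide_eq mult.commute)
  qed
  then have "continuous_map HV.Prod_metric.mtopology Met_TC.mtopology (\<lambda>(a, u). a u :: 'v)"
    unfolding HV.Prod_metric.metric_continuous_map[OF Met_TC.Metric_space_axioms] by auto
  then have "continuous_map
      (mtopology_of (prod_metric (group_norm_metric (hol_group H) L) euclidean_metric))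
      euclidean (\<lambda>(a, u). a u :: 'v)"
    by (simp add: mtopology_of_def)
  moreover have "uniformly_continuous_map
      (prod_metric (group_norm_metric (hol_group H) L) (submetric euclidean_metric B))
      euclidean_metric (\<lambda>(a, u). a u)" if "bounded B" for B
  proof (rule Lipschitz_imp_uniformly_continuous_map)
    from \<open>bounded B\<close> obtain K where K: "\<And>u. u \<in> B \<Longrightarrow> norm u \<le> K"
      by (auto simp: bounded_iff)
    \<comment> \<open>Boundedness replaces \<open>norm u\<close> by \<open>K\<close>, so one
      Lipschitz constant serves all of \<open>H \<times> B\<close>. For empty \<open>B\<close> the
      bound \<open>K\<close> may be negative, but then the estimate is vacuous.\<close>
    have "dist (a u) (b v) \<le> (1 + C * K) * ?d (a, u) (b, v)"
      if "a \<in> H" "b \<in> H" "u \<in> B" for a b u v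
      using that C K[of u] by (intro order.trans[OF bound] mult_right_mono) auto
    then show "Lipschitz_continuous_map
        (prod_metric (group_norm_metric (hol_group H) L) (submetric euclidean_metric B))
        euclidean_metric (\<lambda>(a, u). a u)"
      by (auto simp: Lipschitz_continuous_map_def intro!: exI[of _ "1 + C * K"])
  qed
  ultimately show ?thesis by blast
qed

end
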